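(* Let $\mathfrak g=\mathfrak{gl}(m|n)$ with positive integers $m,n$ satisfying $m+n\ge4$. The Coxeter graph associated with the Coxeter system $(\widehat{\mathscr C},\mathsf S_{\widetilde\Pi})$ of the super Weyl group of $\mathfrak g$ is the chain $$\widehat r_{\overline{1,2}}-\widehat r_{\overline{2,3}}-\cdots-\widehat r_{\overline{m-1,m}}\overset{12}{-}\widehat r_{\overline m1}\overset{12}{-}\widehat r_{1,2}-\widehat r_{2,3}-\cdots-\widehat r_{n-1,n}$$ in which the two edges at $\widehat r_{\overline m1}$ (to $\widehat r_{\overline{m-1,m}}$, present if $m\ge2$, and to $\widehat r_{1,2}$, present if $n\geq 2$) are labelled $12$ and all other edges are unlabelled.
   Context: The ground field is algebraically closed of characteristic $0$. $\mathfrak h$ is the Cartan subalgebra of diagonal matrices of $\mathfrak{gl}(m|n)$; $\mathfrak h^*$ has basis $\delta_1,\dots,\delta_m,\varepsilon_1,\dots,\varepsilon_n$ with bilinear form $(\delta_i,\delta_i)=1$, $(\varepsilon_j,\varepsilon_j)=-1$, other pairings zero. Even roots: $\delta_i-\delta_{i'}$ ($i\ne i'$), $\varepsilon_j-\varepsilon_{j'}$ ($j\ne j'$); odd roots: $\pm(\delta_i-\varepsilon_j)$, all isotropic. $\mathcal B$ is the (finite) set of Borel subalgebras containing $\mathfrak h$, identified with the set of fundamental (simple root) systems. For an isotropic odd root $\gamma$, the odd reflection $\widehat r_\gamma=\widehat r_{-\gamma}$ is the involution of $\mathcal B$ which sends $\Pi_1\ni\gamma$ to $\{-\gamma\}\cup\{\alpha\in\Pi_1: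 (\alpha,\gamma)=0,\alpha\ne\gamma\}\cup\{\alpha+\gamma:\alpha\in\Pi_1,(\alpha,\gamma)\neq0\}$, acts on $\Pi_1\ni-\gamma$ by the same rule with $-\gamma$ in place of $\gamma$, and fixes every fundamental system containing neither $\gamma$ nor $-\gamma$. For an even root $\alpha$, $\widehat r_\alpha$ is the permutation of $\mathcal B$ induced by the ordinary reflection $s_\alpha$. The super Weyl group $\widehat W$ is the group of permutations of $\mathcal B$ generated by all odd and ordinary reflections. $\widetilde\Pi=\Pi=\{\delta_1-\delta_2,\dots,\delta_{m-1}-\delta_m,\delta_m-\varepsilon_1,\varepsilon_1-\varepsilon_2,\dots,\varepsilon_{n-1}-\varepsilon_n\}$ and $\mathsf S_{\widetilde\Pi}=\{\widehat r_\theta:\theta\in\widetilde\Pi\}$, with $\widehat r_{\overline{i,i+1}}=\widehat r_{\delta_i-\delta_{i+1}}$, $\widehat r_{\overline m1}=\widehat r_{\delta_m-\varepsilon_1}$, $\widehat r_{j,j+1}=\widehat r_{\varepsilon_j-\varepsilon_{j+1}}$. The Coxeter group $\widehat{\mathscr C}$ is $\langle x\in\mathsf S_{\widetilde\Pi}\mid (xy)^{m_{xy}}=1\rangle$ where $m_{xy}$ is the order of $xy$ in $\widehat W$. In its Coxeter graph, with vertex set $\mathsf S_{\widetilde\Pi}$, distinct $x,y$ are joined by an edge iff $m_{xy}\ge3$, labelled by $m_{xy}$ if $m_{xy}\ge4$ (no edge means $m_{xy}=2$, an unlabelled edge means $m_{xy}=3$). *)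

theory Defs
  imports
    "HOL-Library.Function_Algebras"
    "HOL-Computational_Algebra.Polynomial"
    "HOL-Algebra.Bij"
    "HOL-Algebra.Elementary_Groups"
    "HOL-Algebra.Multiplicative_Group"
begin

text \<open>
  A weight of the diagonal Cartan subalgebra of \<open>gl(m|n)\<close> is given by its coordinates in the
  basis \<open>\<delta> 1, \<dots>, \<delta> m, \<epsilon> 1, \<dots>, \<epsilon> n\<close>: \<open>Bar i\<close> indexes the coordinate of \<open>\<delta> i\<close> and
  \<open>Plain j\<close> that of \<open>\<epsilon> j\<close>.  Coordinates beyond \<open>m\<close> and \<open>n\<close> vanish on all roots.
\<close>

datatype diag_index = Bar nat | Plain nat

type_synonym 'k weight = "diag_index \<Rightarrow> 'k"

definition \<delta> :: "nat \<Rightarrow> 'k::field weight" where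
  "\<delta> i = (\<lambda>a. if a = Bar i then 1 else 0)"

definition \<epsilon> :: "nat \<Rightarrow> 'k::field weight" where
  "\<epsilon> j = (\<lambda>a. if a = Plain j then 1 else 0)"

definition wform :: "nat \<Rightarrow> nat \<Rightarrow> 'k::field weight \<Rightarrow> 'k weight \<Rightarrow> 'k" where
  "wform m n v w =
     (\<Sum>i=1..m. v (Bar i) * w (Bar i)) - (\<Sum>j=1..n. v (Plain j) * w (Plain j))"

definition even_roots :: "nat \<Rightarrow> nat \<Rightarrow> 'k::field weight set" where
  "even_roots m n =
     {\<delta> i - \<delta> i' | i i'. i \<in> {1..m} \<and> i' \<in> {1..m} \<and> i \<noteq> i'} \<union>
     {\<epsilon> j - \<epsilon> j' | j j'. j \<in> {1..n} \<and> j' \<in> {1..n} \<and> j \<noteq> j'}"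

definition odd_roots :: "nat \<Rightarrow> nat \<Rightarrow> 'k::field weight set" where
  "odd_roots m n =
     {\<delta> i - \<epsilon> j | i j. i \<in> {1..m} \<and> j \<in> {1..n}} \<union>
     {- (\<delta> i - \<epsilon> j) | i j. i \<in> {1..m} \<and> j \<in> {1..n}}"

definition roots :: "nat \<Rightarrow> nat \<Rightarrow> 'k::field weight set" where
  "roots m n = even_roots m n \<union> odd_roots m n"

text \<open>
  The Borel subalgebras containing the Cartan subalgebra are its sums with the root spaces of a
  positive system \<open>P\<close>; since root spaces of \<open>gl(m|n)\<close> satisfy
  \<open>[g_\<alpha>, g_\<beta>] = g_(\<alpha> + \<beta>)\<close> whenever \<open>\<alpha> + \<beta>\<close> is a root, closedness of \<open>P\<close> expresses that this sum
  is a subalgebra.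
\<close>

definition positive_system :: "nat \<Rightarrow> nat \<Rightarrow> 'k::field weight set \<Rightarrow> bool" where
  "positive_system m n P \<longleftrightarrow>
     P \<union> uminus ` P = roots m n \<and> P \<inter> uminus ` P = {} \<and>
     (\<forall>\<alpha>\<in>P. \<forall>\<beta>\<in>P. \<alpha> + \<beta> \<in> roots m n \<longrightarrow> \<alpha> + \<beta> \<in> P)"

definition simple_roots :: "'k::field weight set \<Rightarrow> 'k weight set" where
  "simple_roots P = {\<alpha> \<in> P. \<not> (\<exists>\<beta>\<in>P. \<exists>\<gamma>\<in>P. \<alpha> = \<beta> + \<gamma>)}"

text \<open>A Borel subalgebra is identified with its fundamental system.\<close>

definition borels :: "nat \<Rightarrow> nat \<Rightarrow> 'k::field weight set set" where
  "borels m n = {simple_roots P | P. positive_system m n P}"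

definition odd_change ::
    "nat \<Rightarrow> nat \<Rightarrow> 'k::field weight \<Rightarrow> 'k weight set \<Rightarrow> 'k weight set" where
  "odd_change m n \<gamma> B =
     {- \<gamma>} \<union> {\<alpha> \<in> B. wform m n \<alpha> \<gamma> = 0 \<and> \<alpha> \<noteq> \<gamma>} \<union>
     {\<alpha> + \<gamma> | \<alpha>. \<alpha> \<in> B \<and> wform m n \<alpha> \<gamma> \<noteq> 0}"

definition odd_reflection ::
    "nat \<Rightarrow> nat \<Rightarrow> 'k::field weight \<Rightarrow> 'k weight set \<Rightarrow> 'k weight set" where
  "odd_reflection m n \<gamma> B =
     (if \<gamma> \<in> B then odd_change m n \<gamma> B
      else if - \<gamma> \<in> B then odd_change m n (- \<gamma>) B
      else B)"

definition reflection :: "nat \<Rightarrow> nat \<Rightarrow> 'k::field weight \<Rightarrow> 'k weight \<Rightarrow> 'k weight" where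
  "reflection m n \<alpha> v = (\<lambda>a. v a - 2 * wform m n v \<alpha> / wform m n \<alpha> \<alpha> * \<alpha> a)"

text \<open>Permutations of \<open>borels m n\<close> are extensional functions, as required by \<^const>\<open>BijGroup\<close>.\<close>

definition r_hat ::
    "nat \<Rightarrow> nat \<Rightarrow> 'k::field weight \<Rightarrow> 'k weight set \<Rightarrow> 'k weight set" where
  "r_hat m n \<theta> =
     (\<lambda>B \<in> borels m n.
        if \<theta> \<in> even_roots m n then reflection m n \<theta> ` B else odd_reflection m n \<theta> B)"

definition super_weyl_group ::
    "nat \<Rightarrow> nat \<Rightarrow> ('k::field weight set \<Rightarrow> 'k weight set) monoid" where
  "super_weyl_group m n = subgroup_generated (BijGroup (borels m n)) (r_hat m n ` roots m n)"

definition standard_simple_roots :: "nat \<Rightarrow> nat \<Rightarrow> 'k::field weight set" where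
  "standard_simple_roots m n =
     {\<delta> i - \<delta> (i + 1) | i. 1 \<le> i \<and> i < m} \<union> {\<delta> m - \<epsilon> 1} \<union>
     {\<epsilon> j - \<epsilon> (j + 1) | j. 1 \<le> j \<and> j < n}"

definition coxeter_generators ::
    "nat \<Rightarrow> nat \<Rightarrow> ('k::field weight set \<Rightarrow> 'k weight set) set" where
  "coxeter_generators m n = r_hat m n ` standard_simple_roots m n"

text \<open>The order of \<open>x y\<close>; here, as in \<^const>\<open>group.ord\<close>, infinite order is encoded by \<open>0\<close>.\<close>

definition coxeter_order :: "nat \<Rightarrow> nat \<Rightarrow>
    ('k::field weight set \<Rightarrow> 'k weight set) \<Rightarrow> ('k weight set \<Rightarrow> 'k weight set) \<Rightarrow> nat" where
  "coxeter_order m n x y =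
     group.ord (super_weyl_group m n) (x \<otimes>\<^bsub>super_weyl_group m n\<^esub> y)"

text \<open>
  A Coxeter system is given by its presentation, the generating set \<open>S\<close> and the orders \<open>M x y\<close> in
  the relations \<open>(x y)^(M x y) = 1\<close> (no relation if \<open>M x y = 0\<close>).
\<close>

definition coxeter_matrix :: "'a set \<Rightarrow> ('a \<Rightarrow> 'a \<Rightarrow> nat) \<Rightarrow> bool" where
  "coxeter_matrix S M \<longleftrightarrow>
     (\<forall>x\<in>S. M x x = 1) \<and> (\<forall>x\<in>S. \<forall>y\<in>S. M x y = M y x \<and> (x \<noteq> y \<longrightarrow> M x y \<noteq> 1))"

text \<open>
  Labelled graphs are pairs of a vertex set and a set of edges, each edge carrying an optional
  label.  The infinite order \<open>0\<close> counts as \<open>\<ge> 4\<close>.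
\<close>

type_synonym 'a labelled_graph = "'a set \<times> ('a set \<times> nat option) set"

definition coxeter_graph :: "'a set \<Rightarrow> ('a \<Rightarrow> 'a \<Rightarrow> nat) \<Rightarrow> 'a labelled_graph" where
  "coxeter_graph S M =
     (S, {({x, y}, if M x y = 3 then None else Some (M x y)) | x y.
            x \<in> S \<and> y \<in> S \<and> x \<noteq> y \<and> (M x y \<ge> 3 \<or> M x y = 0)})"

end

theory Submission
  imports Defs "HOL-Combinatorics.Transposition"
begin

text \<open>
  A positive system of \<open>gl(m|n)\<close> is the same as a total order on the \<open>m + n\<close> basis weights, and
  its fundamental system consists of the differences of consecutive weights.  Borel subalgebras are
  therefore the rankings of \<open>m + n\<close> letters, of two kinds (lemma \<open>borels_eq\<close>).
  In this picture the reflection at the difference of two letters exchanges them: always if they are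
  of the same kind (an even root), and only if they are neighbours if they are of different kinds
  (an odd root); see \<open>r_hat_ranked_simple\<close>.  Both rules are the single function \<open>exchange\<close>, and
  since distinct rankings have distinct fundamental systems, the order of a product of two
  generators is the order of a product of two exchanges (lemma \<open>coxeter_order_r_hat\<close>).

  Exchanges of disjoint pairs commute, which gives order 2.  Two exchanges of the same kind that
  share a letter rotate three letters, which gives order 3.  The remaining case is
  \<open>exchange c a\<close>, which is unconditional, followed by or following \<open>exchange a b\<close>, which needs \<open>a\<close>
  and \<open>b\<close> to be neighbours.  The product moves only the ranks of \<open>a\<close>, \<open>b\<close> and \<open>c\<close>, so fix the set of
  their three ranks and join two of the six arrangements if one of the two exchanges swaps them.

    \<^item> If the three ranks are consecutive, the six arrangements form a path
      \<open>acb - cab - cba - abc - bac - bca\<close> on which the two exchanges alternate, and the product is a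
      cycle of length 6.

    \<^item> If just two of the three ranks are consecutive, the graph is a path of four arrangements and
      an edge, and the product has cycles of lengths 4 and 2.

    \<^item> If no two are consecutive, the product is an involution.

  Hence the order is 12, the least common multiple of 6 and 4.  The second situation needs four
  ranks; this is where \<open>m + n \<ge> 4\<close> enters.
\<close>

section \<open>Roots as differences of letters\<close>

definition letters :: "nat \<Rightarrow> nat \<Rightarrow> diag_index set" where
  "letters m n = Bar ` {1..m} \<union> Plain ` {1..n}"

lemma finite_letters [simp]: "finite (letters m n)"
  by (simp add: letters_def)

lemma card_letters [simp]: "card (letters m n) = m + n"
proof -
  have "card (Bar ` {1..m}) = m" "card (Plain ` {1..n}) = n"
    by (simp_all add: card_image inj_on_def)
  moreover have "Bar ` {1..m} \<inter> Plain ` {1..n} = {}" by auto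
  ultimately show ?thesis by (simp add: letters_def card_Un_disjoint)
qed

fun same_kind :: "diag_index \<Rightarrow> diag_index \<Rightarrow> bool" where
  "same_kind (Bar _) (Bar _) = True"
| "same_kind (Plain _) (Plain _) = True"
| "same_kind _ _ = False"

lemma same_kind_commute: "same_kind a b = same_kind b a"
  by (cases a; cases b) simp_all

definition unit_weight :: "diag_index \<Rightarrow> 'k::field weight" where
  "unit_weight a = (\<lambda>b. if b = a then 1 else 0)"

definition pair_root :: "diag_index \<Rightarrow> diag_index \<Rightarrow> 'k::field weight" where
  "pair_root a b = unit_weight a - unit_weight b"

lemma pair_root_apply: "pair_root a b c = (if c = a then 1 else 0) - (if c = b then 1 else 0)"
  by (simp add: pair_root_def unit_weight_def)

lemma delta_eq: "\<delta> i = unit_weight (Bar i)" and epsilon_eq: "\<epsilon> j = unit_weight (Plain j)"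
  by (simp_all add: \<delta>_def \<epsilon>_def unit_weight_def)

lemma uminus_root [simp]: "- pair_root a b = pair_root b a"
  by (simp add: pair_root_def)

lemma pair_root_add [simp]: "pair_root a b + pair_root b c = pair_root a c"
  by (simp add: pair_root_def)

lemma pair_root_eq_iff:
  assumes "a \<noteq> b" "c \<noteq> d"
  shows "(pair_root a b :: 'k::field_char_0 weight) = pair_root c d \<longleftrightarrow> a = c \<and> b = d"
proof
  assume eq: "(pair_root a b :: 'k weight) = pair_root c d"
  have "(if a = c then 1 else 0) - (if a = d then 1 else 0) = (1::'k)"
    using fun_cong[OF eq, of a] assms(1) unfolding pair_root_def unit_weight_def fun_diff_def by simp
  then have "a = c" using one_neq_neg_one[where 'a='k] by (cases "a = c"; cases "a = d") simp_all
  have "(if b = c then 1 else 0) - (if b = d then 1 else 0) = (- 1::'k)"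
    using fun_cong[OF eq, of b] assms(1) unfolding pair_root_def unit_weight_def fun_diff_def by simp
  then have "b = d" using one_neq_neg_one[where 'a='k] by (cases "b = c"; cases "b = d") simp_all
  with \<open>a = c\<close> show "a = c \<and> b = d" by simp
qed simp

lemma even_roots_eq:
  "even_roots m n = {pair_root a b | a b. a \<in> letters m n \<and> b \<in> letters m n \<and> a \<noteq> b \<and> same_kind a b}"
  (is "_ = ?R")
proof
  show "even_roots m n \<subseteq> ?R"
    by (fastforce simp: even_roots_def letters_def pair_root_def delta_eq epsilon_eq)
  show "?R \<subseteq> even_roots m n"
    by (auto simp: even_roots_def letters_def pair_root_def delta_eq epsilon_eq)
qed

lemma odd_roots_eq:
  "odd_roots m n = {pair_root a b | a b. a \<in> letters m n \<and> b \<in> letters m n \<and> \<not> same_kind a b}"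
  (is "_ = ?R")
proof
  show "odd_roots m n \<subseteq> ?R"
    by (fastforce simp: odd_roots_def letters_def pair_root_def delta_eq epsilon_eq)
  show "?R \<subseteq> odd_roots m n"
    by (fastforce simp: odd_roots_def letters_def pair_root_def delta_eq epsilon_eq)
qed

lemma roots_eq:
  "roots m n = {pair_root a b | a b. a \<in> letters m n \<and> b \<in> letters m n \<and> a \<noteq> b}"
proof -
  have "a \<noteq> b" if "\<not> same_kind a b" for a b using that by (cases a; cases b) auto
  then show ?thesis unfolding roots_def even_roots_eq odd_roots_eq by blast
qed

definition norm_sign :: "diag_index \<Rightarrow> 'k::field" where
  "norm_sign a = (case a of Bar _ \<Rightarrow> 1 | Plain _ \<Rightarrow> - 1)"

lemma wform_unit_weight:
  assumes "a \<in> letters m n"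
  shows "wform m n v (unit_weight a) = norm_sign a * v a"
proof -
  have "(\<Sum>i = 1..m. v (Bar i) * unit_weight a (Bar i)) =
      (case a of Bar i \<Rightarrow> v a | Plain j \<Rightarrow> 0)"
    using assms by (cases a) (auto simp: unit_weight_def letters_def if_distrib cong: if_cong)
  moreover have "(\<Sum>j = 1..n. v (Plain j) * unit_weight a (Plain j)) =
      (case a of Bar i \<Rightarrow> 0 | Plain j \<Rightarrow> v a)"
    using assms by (cases a) (auto simp: unit_weight_def letters_def if_distrib cong: if_cong)
  ultimately show ?thesis by (simp add: wform_def norm_sign_def split: diag_index.split)
qed

lemma wform_root:
  assumes "a \<in> letters m n" "b \<in> letters m n"
  shows "wform m n v (pair_root a b) = norm_sign a * v a - norm_sign b * v b"
proof -
  have "wform m n v (pair_root a b) = wform m n v (unit_weight a) - wform m n v (unit_weight b)"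
    by (simp add: wform_def pair_root_def right_diff_distrib sum_subtractf)
  then show ?thesis using assms by (simp add: wform_unit_weight)
qed

section \<open>Borel subalgebras as rankings of the letters\<close>

text \<open>
  Rankings are extensional so that two of them which agree on the letters are equal.
\<close>

definition rankings :: "nat \<Rightarrow> nat \<Rightarrow> (diag_index \<Rightarrow> nat) set" where
  "rankings m n = {p \<in> extensional (letters m n). bij_betw p (letters m n) {..<m + n}}"

lemma rankings_inj:
  assumes "p \<in> rankings m n" "a \<in> letters m n" "b \<in> letters m n" "p a = p b"
  shows "a = b"
  using assms by (auto simp: rankings_def bij_betw_def inj_on_def)

lemma rankings_less:
  assumes "p \<in> rankings m n" "a \<in> letters m n"
  shows "p a < m + n"
  using assms by (auto simp: rankings_def bij_betw_def)

lemma rankings_surj: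
  assumes "p \<in> rankings m n" "k < m + n"
  obtains a where "a \<in> letters m n" "p a = k"
proof -
  have "k \<in> p ` letters m n" using assms by (simp add: rankings_def bij_betw_def)
  then show thesis using that by blast
qed

definition ranked_positive :: "nat \<Rightarrow> nat \<Rightarrow> (diag_index \<Rightarrow> nat) \<Rightarrow> 'k::field weight set" where
  "ranked_positive m n p = {pair_root a b | a b. a \<in> letters m n \<and> b \<in> letters m n \<and> p a < p b}"

definition ranked_simple :: "nat \<Rightarrow> nat \<Rightarrow> (diag_index \<Rightarrow> nat) \<Rightarrow> 'k::field weight set" where
  "ranked_simple m n p = {pair_root a b | a b. a \<in> letters m n \<and> b \<in> letters m n \<and> p b = Suc (p a)}"

lemma ranked_positiveI:
  "a \<in> letters m n \<Longrightarrow> b \<in> letters m n \<Longrightarrow> p a < p b \<Longrightarrow> pair_root a b \<in> ranked_positive m n p"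
  unfolding ranked_positive_def by blast

lemma ranked_positiveE:
  assumes "v \<in> ranked_positive m n p"
  obtains a b where "v = pair_root a b" "a \<in> letters m n" "b \<in> letters m n" "p a < p b"
  using assms unfolding ranked_positive_def by blast

lemma ranked_simpleI:
  "a \<in> letters m n \<Longrightarrow> b \<in> letters m n \<Longrightarrow> p b = Suc (p a) \<Longrightarrow> pair_root a b \<in> ranked_simple m n p"
  unfolding ranked_simple_def by blast

lemma ranked_simpleE:
  assumes "v \<in> ranked_simple m n p"
  obtains a b where "v = pair_root a b" "a \<in> letters m n" "b \<in> letters m n" "p b = Suc (p a)"
  using assms unfolding ranked_simple_def by blast

lemma pair_root_in_ranked_positive:
  assumes "a \<in> letters m n" "b \<in> letters m n" "a \<noteq> b"
  shows "(pair_root a b :: 'k::field_char_0 weight) \<in> ranked_positive m n p \<longleftrightarrow> p a < p b"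
proof
  assume "(pair_root a b :: 'k weight) \<in> ranked_positive m n p"
  then obtain c d where "(pair_root a b :: 'k weight) = pair_root c d" "p c < p d"
    by (auto simp: ranked_positive_def)
  moreover from this have "c \<noteq> d" by auto
  ultimately show "p a < p b" using assms(3) by (simp add: pair_root_eq_iff)
qed (use assms in \<open>auto intro: ranked_positiveI\<close>)

lemma pair_root_in_ranked_simple:
  assumes "a \<in> letters m n" "b \<in> letters m n" "a \<noteq> b"
  shows "(pair_root a b :: 'k::field_char_0 weight) \<in> ranked_simple m n p \<longleftrightarrow> p b = Suc (p a)"
proof
  assume "(pair_root a b :: 'k weight) \<in> ranked_simple m n p"
  then obtain c d where "(pair_root a b :: 'k weight) = pair_root c d" "p d = Suc (p c)"
    by (auto simp: ranked_simple_def)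
  moreover from this have "c \<noteq> d" by auto
  ultimately show "p b = Suc (p a)" using assms(3) by (simp add: pair_root_eq_iff)
qed (use assms in \<open>auto intro: ranked_simpleI\<close>)

text \<open>
  The linear functional that sends each letter to its rank turns a relation between roots into one
  between ranks.  The ranks may be compared as natural numbers because the field has
  characteristic 0.
\<close>

lemma rank_sum_root:
  assumes "(pair_root a b :: 'k::field_char_0 weight) = pair_root c d + pair_root c' d'"
    and "{a, b, c, d, c', d'} \<subseteq> letters m n"
  shows "p a + p d + p d' = p b + p c + (p c' :: nat)"
proof -
  define h :: "'k weight \<Rightarrow> 'k" where "h v = (\<Sum>x\<in>letters m n. of_nat (p x) * v x)" for v
  have h_unit: "h (unit_weight x) = of_nat (p x)" if "x \<in> letters m n" for x
    using that by (simp add: h_def unit_weight_def if_distrib cong: if_cong)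
  have h_add: "h (v + w) = h v + h w" for v w
    by (simp add: h_def distrib_left sum.distrib)
  have h_root: "h (pair_root x y) = of_nat (p x) - of_nat (p y)"
    if "x \<in> letters m n" "y \<in> letters m n" for x y
    using that h_unit h_add[of "pair_root x y" "unit_weight y"] by (simp add: pair_root_def algebra_simps)
  have "of_nat (p a) - of_nat (p b) = (of_nat (p c) - of_nat (p d) + (of_nat (p c') - of_nat (p d')) :: 'k)"
    using arg_cong[OF assms(1), of h] assms(2) by (simp add: h_add h_root)
  then have "(of_nat (p a + p d + p d') :: 'k) = of_nat (p b + p c + p c')"
    by (simp add: algebra_simps)
  then show ?thesis by (simp only: of_nat_eq_iff)
qed

lemma positive_system_ranked_positive:
  assumes p: "p \<in> rankings m n"
  shows "positive_system m n (ranked_positive m n p :: 'k::field_char_0 weight set)"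
  unfolding positive_system_def
proof (intro conjI ballI impI)
  let ?P = "ranked_positive m n p :: 'k weight set"
  have neg: "uminus ` ?P = {pair_root a b | a b. a \<in> letters m n \<and> b \<in> letters m n \<and> p b < p a}"
    unfolding ranked_positive_def by (auto simp: image_iff) (metis uminus_root)+
  show "?P \<union> uminus ` ?P = roots m n"
  proof
    show "?P \<union> uminus ` ?P \<subseteq> roots m n"
      unfolding neg roots_eq unfolding ranked_positive_def by fastforce
    show "roots m n \<subseteq> ?P \<union> uminus ` ?P"
    proof
      fix v :: "'k weight" assume "v \<in> roots m n"
      then obtain a b where "v = pair_root a b" "a \<in> letters m n" "b \<in> letters m n" "a \<noteq> b"
        by (auto simp: roots_eq)
      moreover from this have "p a < p b \<or> p b < p a" using rankings_inj[OF p, of a b] by linarith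
      ultimately show "v \<in> ?P \<union> uminus ` ?P"
        unfolding neg unfolding ranked_positive_def by blast
    qed
  qed
  show "?P \<inter> uminus ` ?P = {}"
  proof -
    have False if "v \<in> ?P" "v \<in> uminus ` ?P" for v
    proof -
      from that(2) obtain a b where "v = pair_root a b" "a \<in> letters m n" "b \<in> letters m n" "p b < p a"
        unfolding neg by blast
      with that(1) pair_root_in_ranked_positive[where 'k='k and p=p, of a m n b] show False by fastforce
    qed
    then show ?thesis by blast
  qed
  fix v w assume "v \<in> ?P" "w \<in> ?P" "v + w \<in> roots m n"
  then obtain a b c d c' d' where
    v: "v = pair_root c d" "c \<in> letters m n" "d \<in> letters m n" "p c < p d" and
    w: "w = pair_root c' d'" "c' \<in> letters m n" "d' \<in> letters m n" "p c' < p d'" and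
    vw: "v + w = pair_root a b" "a \<in> letters m n" "b \<in> letters m n"
    unfolding ranked_positive_def roots_eq by blast
  have "p a + p d + p d' = p b + p c + p c'"
    by (rule rank_sum_root[where 'k='k and m=m and n=n]) (use v w vw in auto)
  then show "v + w \<in> ?P"
    unfolding vw(1) by (intro ranked_positiveI) (use v w vw in auto)
qed

text \<open>
  A difference of letters whose ranks are further apart splits at any letter in between; one whose
  ranks are consecutive cannot be a sum of two positive roots, since rank differences add up.
\<close>

lemma simple_roots_ranked_positive:
  assumes p: "p \<in> rankings m n"
  shows "simple_roots (ranked_positive m n p) = (ranked_simple m n p :: 'k::field_char_0 weight set)"
    (is "simple_roots ?P = ?S")
proof
  show "simple_roots ?P \<subseteq> ?S"
  proof
    fix v assume v: "v \<in> simple_roots ?P"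
    then obtain a b where ab: "v = pair_root a b" "a \<in> letters m n" "b \<in> letters m n" "p a < p b"
      by (auto simp: simple_roots_def elim: ranked_positiveE)
    have "p b = Suc (p a)"
    proof (rule ccontr)
      assume "p b \<noteq> Suc (p a)"
      with ab have gap: "Suc (p a) < p b" by simp
      with rankings_less[OF p ab(3)] obtain c where c: "c \<in> letters m n" "p c = Suc (p a)"
        using rankings_surj[OF p, of "Suc (p a)"] by auto
      have "pair_root a c \<in> ?P" "pair_root c b \<in> ?P" using ab c gap by (auto intro: ranked_positiveI)
      moreover have "v = pair_root a c + pair_root c b" by (simp add: ab)
      ultimately show False using v unfolding simple_roots_def by blast
    qed
    with ab show "v \<in> ?S" by (auto intro: ranked_simpleI)
  qed
  show "?S \<subseteq> simple_roots ?P"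
  proof
    fix v assume "v \<in> ?S"
    then obtain a b where ab: "v = pair_root a b" "a \<in> letters m n" "b \<in> letters m n" "p b = Suc (p a)"
      by (rule ranked_simpleE)
    have False if "u \<in> ?P" "w \<in> ?P" "v = u + w" for u w
    proof -
      from that obtain c d c' d' where
        u: "u = pair_root c d" "c \<in> letters m n" "d \<in> letters m n" "p c < p d" and
        w: "w = pair_root c' d'" "c' \<in> letters m n" "d' \<in> letters m n" "p c' < p d'"
        unfolding ranked_positive_def by blast
      have "p a + p d + p d' = p b + p c + p c'"
        by (rule rank_sum_root[where 'k='k and m=m and n=n]) (use u w ab that in auto)
      with ab u w show False by simp
    qed
    with ab show "v \<in> simple_roots ?P"
      unfolding simple_roots_def by (auto intro: ranked_positiveI)
  qed
qed

text \<open>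
  The letters are totally ordered by the sign of their difference.  Transitivity is closedness of
  the positive system, and the rank of a letter is the number of its predecessors.
\<close>

lemma positive_system_imp_ranked:
  assumes P: "positive_system m n (P :: 'k::field_char_0 weight set)"
  obtains p where "p \<in> rankings m n" "P = ranked_positive m n p"
proof -
  let ?L = "letters m n"
  define lt where "lt a b \<longleftrightarrow> a \<in> ?L \<and> b \<in> ?L \<and> a \<noteq> b \<and> pair_root a b \<in> P" for a b
  have cover: "roots m n = P \<union> uminus ` P" and disj: "P \<inter> uminus ` P = {}"
    using P by (simp_all add: positive_system_def)
  have closed: "v + w \<in> P" if "v \<in> P" "w \<in> P" "v + w \<in> roots m n" for v w
    using P that by (simp add: positive_system_def)
  have P_roots: "P \<subseteq> roots m n" using cover by simp
  have asym: "\<not> lt b a" if "lt a b" for a b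
  proof
    assume "lt b a"
    then have "- pair_root a b \<in> P" by (simp add: lt_def)
    moreover have "- (- pair_root a b) \<in> uminus ` P" using calculation by blast
    ultimately show False using that disj by (auto simp: lt_def)
  qed
  have total: "lt a b \<or> lt b a" if "a \<in> ?L" "b \<in> ?L" "a \<noteq> b" for a b
  proof -
    have "(pair_root a b :: 'k weight) \<in> roots m n" using that by (auto simp: roots_eq)
    then have "pair_root a b \<in> P \<or> - pair_root a b \<in> P" unfolding cover by (metis UnE imageE minus_minus)
    then show ?thesis using that by (auto simp: lt_def)
  qed
  have trans: "lt a c" if "lt a b" "lt b c" for a b c
  proof -
    have "a \<noteq> c" using asym that by blast
    then have "(pair_root a b + pair_root b c :: 'k weight) \<in> roots m n"
      using that unfolding roots_eq lt_def by auto
    then have "pair_root a b + pair_root b c \<in> P"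
      using that by (intro closed) (simp_all add: lt_def)
    then show ?thesis using that \<open>a \<noteq> c\<close> by (simp add: lt_def)
  qed
  define p where "p = (\<lambda>a\<in>?L. card {c. lt c a})"
  have fin: "finite {c. lt c a}" for a
    by (rule finite_subset[OF _ finite_letters[of m n]]) (auto simp: lt_def)
  have mono: "p a < p b" if "lt a b" for a b
  proof -
    have "a \<in> ?L" "b \<in> ?L" using that by (auto simp: lt_def)
    moreover have "{c. lt c a} \<subset> {c. lt c b}" using that trans asym by blast
    ultimately show ?thesis by (simp add: p_def psubset_card_mono[OF fin])
  qed
  have iff: "lt a b \<longleftrightarrow> p a < p b" if "a \<in> ?L" "b \<in> ?L" for a b
    using mono[of a b] mono[of b a] total[OF that] by fastforce
  have "inj_on p ?L"
  proof (rule inj_onI)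
    fix a b assume "a \<in> ?L" "b \<in> ?L" "p a = p b"
    then show "a = b" using total[of a b] mono[of a b] mono[of b a] by auto
  qed
  moreover have "p a < m + n" if "a \<in> ?L" for a
  proof -
    have "{c. lt c a} \<subset> ?L" using that by (auto simp: lt_def)
    then have "card {c. lt c a} < card ?L" by (rule psubset_card_mono[OF finite_letters])
    then show ?thesis using that by (simp add: p_def)
  qed
  moreover have "p ` ?L = {..<m + n}"
    by (rule card_subset_eq) (use calculation in \<open>auto simp: card_image\<close>)
  ultimately have "bij_betw p ?L {..<m + n}"
    by (simp add: bij_betw_def)
  then have ranking: "p \<in> rankings m n" by (simp add: rankings_def p_def)
  have "P = ranked_positive m n p"
  proof
    show "P \<subseteq> ranked_positive m n p"
    proof
      fix v assume "v \<in> P"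
      moreover from this P_roots obtain a b
        where "v = pair_root a b" "a \<in> ?L" "b \<in> ?L" "a \<noteq> b" by (auto simp: roots_eq)
      ultimately show "v \<in> ranked_positive m n p"
        using mono[of a b] by (auto simp: lt_def intro: ranked_positiveI)
    qed
    show "ranked_positive m n p \<subseteq> P"
      using iff by (auto simp: lt_def elim!: ranked_positiveE)
  qed
  with ranking that show thesis by blast
qed

lemma borels_eq: "(borels m n :: 'k::field_char_0 weight set set) = ranked_simple m n ` rankings m n"
proof
  show "borels m n \<subseteq> (ranked_simple m n ` rankings m n :: 'k weight set set)"
  proof
    fix B :: "'k weight set" assume "B \<in> borels m n"
    then obtain P where P: "B = simple_roots P" "positive_system m n P"
      by (auto simp: borels_def)
    from P(2) obtain p where "p \<in> rankings m n" "P = ranked_positive m n p"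
      by (rule positive_system_imp_ranked)
    with P(1) show "B \<in> ranked_simple m n ` rankings m n"
      by (simp add: simple_roots_ranked_positive)
  qed
  show "ranked_simple m n ` rankings m n \<subseteq> (borels m n :: 'k weight set set)"
  proof
    fix B :: "'k weight set" assume "B \<in> ranked_simple m n ` rankings m n"
    then obtain p where p: "p \<in> rankings m n" "B = ranked_simple m n p" by blast
    then have "B = simple_roots (ranked_positive m n p)"
      by (simp add: simple_roots_ranked_positive)
    then show "B \<in> borels m n"
      using positive_system_ranked_positive[OF p(1), where 'k='k] unfolding borels_def by blast
  qed
qed

text \<open>
  A fundamental system tells which letters follow each other.  Hence rankings with the same system
  differ by a constant shift, and the bound \<open>m + n\<close> on the ranks forces the shift to vanish.
\<close>

lemma inj_on_ranked_simple:
  "inj_on (ranked_simple m n :: _ \<Rightarrow> 'k::field_char_0 weight set) (rankings m n)"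
proof (rule inj_onI)
  fix p q
  assume p: "p \<in> rankings m n" and q: "q \<in> rankings m n"
    and eq: "ranked_simple m n p = (ranked_simple m n q :: 'k weight set)"
  have offset: "\<exists>a0\<in>letters m n. p a0 = 0 \<and> q a = q a0 + p a" if "a \<in> letters m n" for a
    using that
  proof (induction "p a" arbitrary: a)
    case 0 then show ?case by (intro bexI[of _ a]) simp_all
  next
    case (Suc k)
    then have "k < m + n" using rankings_less[OF p, of a] by simp
    then obtain b where b: "b \<in> letters m n" "p b = k" by (rule rankings_surj[OF p])
    with Suc have "a \<noteq> b" "p a = Suc (p b)" by auto
    with b Suc eq pair_root_in_ranked_simple[of b m n a p, where 'k='k]
      pair_root_in_ranked_simple[of b m n a q, where 'k='k]
    have "q a = Suc (q b)" by auto
    moreover from Suc(1)[of b] b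
    obtain a0 where "a0 \<in> letters m n" "p a0 = 0" "q b = q a0 + p b" by auto
    ultimately show ?case using \<open>p a = Suc (p b)\<close> by (intro bexI[of _ a0]) simp_all
  qed
  show "p = q"
  proof (rule extensionalityI[of _ "letters m n"])
    fix a assume a: "a \<in> letters m n"
    then have "m + n - 1 < m + n" using rankings_less[OF p a] by simp
    then obtain b where b: "b \<in> letters m n" "p b = m + n - 1" by (rule rankings_surj[OF p])
    from offset[OF a] offset[OF b(1)] obtain a0 b0 where
      "a0 \<in> letters m n" "p a0 = 0" "q a = q a0 + p a"
      "b0 \<in> letters m n" "p b0 = 0" "q b = q b0 + p b" by blast
    moreover from this have "a0 = b0" using rankings_inj[OF p] by simp
    moreover have "q b < m + n" using rankings_less[OF q b(1)] .
    ultimately show "p a = q a" using b(2) by simp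
  qed (use p q in \<open>auto simp: rankings_def\<close>)
qed

text \<open>
  This supplies the witnesses for the lower bounds on orders, which only prescribe the ranks of two
  or three letters.
\<close>

lemma rankings_extend:
  assumes A: "A \<subseteq> letters m n" and inj: "inj_on g A" and g: "g ` A \<subseteq> {..<m + n}"
  obtains p where "p \<in> rankings m n" "\<And>a. a \<in> A \<Longrightarrow> p a = g a"
proof -
  let ?L = "letters m n"
  have fin: "finite A" using A finite_letters by (rule finite_subset)
  have "card (?L - A) = card ({..<m + n} - g ` A)"
    using A g fin by (simp add: card_Diff_subset card_image[OF inj])
  then obtain h where h: "bij_betw h (?L - A) ({..<m + n} - g ` A)"
    using finite_same_card_bij[of "?L - A" "{..<m + n} - g ` A"] by auto
  define f where "f a = (if a \<in> A then g a else h a)" for a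
  have "bij_betw f A (g ` A)"
    using inj by (simp add: f_def bij_betw_def inj_on_def)
  moreover have "bij_betw f (?L - A) ({..<m + n} - g ` A)"
    using h by (subst bij_betw_cong[of _ _ h]) (simp_all add: f_def)
  ultimately have "bij_betw f (A \<union> (?L - A)) (g ` A \<union> ({..<m + n} - g ` A))"
    by (rule bij_betw_combine) auto
  moreover have "A \<union> (?L - A) = ?L" "g ` A \<union> ({..<m + n} - g ` A) = {..<m + n}"
    using A g by auto
  ultimately have "bij_betw f ?L {..<m + n}" by simp
  then have "restrict f ?L \<in> rankings m n" by (simp add: rankings_def)
  moreover have "restrict f ?L a = g a" if "a \<in> A" for a using A that by (auto simp: f_def)
  ultimately show thesis using that by blast
qed

section \<open>Reflections as exchanges of letters\<close>

definition adjacent :: "nat \<Rightarrow> nat \<Rightarrow> bool" where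
  "adjacent u v \<longleftrightarrow> v = Suc u \<or> u = Suc v"

lemma adjacent_commute: "adjacent u v = adjacent v u"
  by (auto simp: adjacent_def)

definition exchange :: "diag_index \<Rightarrow> diag_index \<Rightarrow> (diag_index \<Rightarrow> nat) \<Rightarrow> diag_index \<Rightarrow> nat" where
  "exchange a b p = (if same_kind a b \<or> adjacent (p a) (p b) then p \<circ> transpose a b else p)"

lemma exchange_commute: "exchange a b = exchange b a"
  by (simp add: exchange_def fun_eq_iff same_kind_commute[of a] adjacent_commute[of "_ a"]
      transpose_commute[of a])

lemma exchange_apply:
  "exchange a b p a = (if same_kind a b \<or> adjacent (p a) (p b) then p b else p a)"
  "exchange a b p b = (if same_kind a b \<or> adjacent (p a) (p b) then p a else p b)"
  "c \<noteq> a \<Longrightarrow> c \<noteq> b \<Longrightarrow> exchange a b p c = p c"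
  by (auto simp: exchange_def)

lemma exchange_involutory: "exchange a b (exchange a b p) = p"
  by (simp add: exchange_def adjacent_commute[of "p b"] comp_assoc)

lemma transpose_in_letters:
  "a \<in> letters m n \<Longrightarrow> b \<in> letters m n \<Longrightarrow> transpose a b c \<in> letters m n \<longleftrightarrow> c \<in> letters m n"
  by (auto simp: transpose_def)

lemma transposed_ranking:
  assumes "a \<in> letters m n" "b \<in> letters m n" "p \<in> rankings m n"
  shows "p \<circ> transpose a b \<in> rankings m n"
proof -
  have "bij_betw (transpose a b) (letters m n) (letters m n)"
    using assms by (intro bij_betwI[of _ _ _ "transpose a b"]) (auto simp: transpose_in_letters)
  moreover have "p \<circ> transpose a b \<in> extensional (letters m n)"
    using assms by (auto simp: rankings_def extensional_def transpose_in_letters)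
  ultimately show ?thesis using assms(3) bij_betw_trans by (auto simp: rankings_def)
qed

lemma exchange_ranking:
  assumes "a \<in> letters m n" "b \<in> letters m n" "p \<in> rankings m n"
  shows "exchange a b p \<in> rankings m n"
  using transposed_ranking[OF assms] assms by (simp add: exchange_def)

lemma ranked_simple_transposed:
  assumes "a \<in> letters m n" "b \<in> letters m n"
  shows "ranked_simple m n (p \<circ> transpose a b) =
    {pair_root (transpose a b c) (transpose a b d) | c d.
       c \<in> letters m n \<and> d \<in> letters m n \<and> p d = Suc (p c)}" (is "?S = ?T")
proof
  let ?t = "transpose a b"
  show "?S \<subseteq> ?T"
  proof
    fix v assume "v \<in> ?S"
    then obtain c d where v: "v = pair_root c d" "c \<in> letters m n" "d \<in> letters m n"
      and "(p \<circ> ?t) d = Suc ((p \<circ> ?t) c)" by (rule ranked_simpleE)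
    then have "p (?t d) = Suc (p (?t c))" by simp
    moreover have "?t c \<in> letters m n" "?t d \<in> letters m n"
      using v assms by (simp_all add: transpose_in_letters)
    moreover have "v = pair_root (?t (?t c)) (?t (?t d))" using v by simp
    ultimately show "v \<in> ?T" by blast
  qed
  show "?T \<subseteq> ?S"
  proof
    fix v assume "v \<in> ?T"
    then obtain c d where "v = pair_root (?t c) (?t d)" "c \<in> letters m n" "d \<in> letters m n"
      "p d = Suc (p c)" by blast
    then show "v \<in> ?S" using assms by (auto intro!: ranked_simpleI simp: transpose_in_letters)
  qed
qed

lemma reflection_root:
  assumes "a \<in> letters m n" "b \<in> letters m n" "a \<noteq> b" "same_kind a b"
  shows "reflection m n (pair_root a b) (pair_root c d) = (pair_root (transpose a b c) (transpose a b d) :: 'k::field_char_0 weight)"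
proof -
  have sign: "norm_sign b = (norm_sign a :: 'k)" "norm_sign a \<noteq> (0 :: 'k)"
    using assms(4) by (cases a; cases b; simp add: norm_sign_def)+
  have "(pair_root a b :: 'k weight) a = 1" "(pair_root a b :: 'k weight) b = - 1"
    using assms(3) by (simp_all add: pair_root_def unit_weight_def)
  then have "wform m n (pair_root a b) (pair_root a b) = 2 * (norm_sign a :: 'k)"
    using assms by (simp add: wform_root sign)
  moreover have "wform m n (pair_root c d) (pair_root a b) = norm_sign a * ((pair_root c d :: 'k weight) a - pair_root c d b)"
    using assms by (simp add: wform_root sign right_diff_distrib)
  ultimately have "reflection m n (pair_root a b) (pair_root c d) =
      (\<lambda>x. pair_root c d x - (pair_root c d a - pair_root c d b) * (pair_root a b x :: 'k))"
    using sign(2) by (simp add: reflection_def)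
  also have "\<dots> = pair_root (transpose a b c) (transpose a b d)"
    using assms(3) by (auto simp: pair_root_def unit_weight_def transpose_def fun_eq_iff)
  finally show ?thesis .
qed

lemma pair_root_in_even_roots:
  assumes "a \<in> letters m n" "b \<in> letters m n" "a \<noteq> b"
  shows "(pair_root a b :: 'k::field_char_0 weight) \<in> even_roots m n \<longleftrightarrow> same_kind a b"
proof
  assume "(pair_root a b :: 'k weight) \<in> even_roots m n"
  then obtain c d where "(pair_root a b :: 'k weight) = pair_root c d" "c \<noteq> d" "same_kind c d"
    by (auto simp: even_roots_eq)
  then show "same_kind a b" using assms(3) by (simp add: pair_root_eq_iff)
qed (use assms in \<open>auto simp: even_roots_eq\<close>)

lemma reflection_ranked_simple:
  assumes "a \<in> letters m n" "b \<in> letters m n" "a \<noteq> b" "same_kind a b"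
  shows "reflection m n (pair_root a b) ` ranked_simple m n p =
    (ranked_simple m n (p \<circ> transpose a b) :: 'k::field_char_0 weight set)"
proof -
  have "reflection m n (pair_root a b) ` ranked_simple m n p =
      {reflection m n (pair_root a b) (pair_root c d) :: 'k weight | c d.
         c \<in> letters m n \<and> d \<in> letters m n \<and> p d = Suc (p c)}"
    unfolding ranked_simple_def by blast
  then show ?thesis
    using assms by (simp add: reflection_root ranked_simple_transposed)
qed

text \<open>
  Let \<open>a\<close> be ranked just before \<open>b\<close>.  Exchanging them negates their difference.  The root ending in
  \<open>a\<close> now ends in \<open>b\<close> and the root starting in \<open>b\<close> now starts in \<open>a\<close>; both changes add
  \<open>pair_root a b\<close>.  These two are exactly the simple roots not orthogonal to it, the root itself
  being isotropic because the two letters have opposite squared lengths.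
\<close>

lemma odd_change_ranked_simple:
  assumes ab: "a \<in> letters m n" "b \<in> letters m n" "\<not> same_kind a b"
    and p: "p \<in> rankings m n" and adj: "p b = Suc (p a)"
  shows "odd_change m n (pair_root a b) (ranked_simple m n p) =
    (ranked_simple m n (p \<circ> transpose a b) :: 'k::field_char_0 weight set)"
proof -
  let ?t = "transpose a b" and ?\<gamma> = "pair_root a b :: 'k weight"
  define step where "step c d \<longleftrightarrow> c \<in> letters m n \<and> d \<in> letters m n \<and> p d = Suc (p c)" for c d
  have "a \<noteq> b" using adj by auto
  have sign: "norm_sign b = - (norm_sign a :: 'k)" "norm_sign a \<noteq> (0 :: 'k)"
    using ab(3) by (cases a; cases b; simp add: norm_sign_def)+
  have step_b: "c = a" if "step c b" for c
    using that adj ab rankings_inj[OF p, of c a] by (simp add: step_def)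
  have step_a: "d = b" if "step a d" for d
    using that adj ab rankings_inj[OF p, of d b] by (simp add: step_def)
  have not_refl: "\<not> step c c" for c by (simp add: step_def)
  have step_cases: "c = a \<and> d = b \<or> d = a \<and> c \<noteq> a \<and> c \<noteq> b \<or> c = b \<and> d \<noteq> a \<and> d \<noteq> b \<or>
      c \<noteq> a \<and> c \<noteq> b \<and> d \<noteq> a \<and> d \<noteq> b" if "step c d" for c d
  proof -
    have "\<not> step b a" using adj by (simp add: step_def)
    then show ?thesis using that step_a step_b not_refl by blast
  qed
  \<comment> \<open>Only the two neighbours of the pair are not orthogonal to its pair_root.\<close>
  have form: "wform m n (pair_root c d) ?\<gamma> \<noteq> 0 \<longleftrightarrow> (d = a \<or> c = b)" if "step c d" for c d
  proof -
    have "wform m n (pair_root c d) ?\<gamma> = norm_sign a * (pair_root c d a + pair_root c d b)"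
      using ab by (simp add: wform_root sign distrib_left)
    moreover have "pair_root c d a + pair_root c d b \<noteq> (0::'k) \<longleftrightarrow> (d = a \<or> c = b)"
      using step_cases[OF that] \<open>a \<noteq> b\<close> by (elim disjE conjE) (simp_all add: pair_root_apply)
    ultimately show ?thesis using sign(2) by simp
  qed
  have moved: "(if c = a \<and> d = b then - ?\<gamma>
      else if wform m n (pair_root c d) ?\<gamma> = 0 then pair_root c d else pair_root c d + ?\<gamma>) = pair_root (?t c) (?t d)"
    if "step c d" for c d
    using step_cases[OF that] form[OF that] \<open>a \<noteq> b\<close>
    by (elim disjE conjE) (simp_all add: add.commute[of "pair_root b d"])
  have "step a b" using ab adj by (simp add: step_def)
  have S: "ranked_simple m n p = {pair_root c d | c d. step c d}"
    by (simp add: ranked_simple_def step_def)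
  have neq: "pair_root c d = ?\<gamma> \<longleftrightarrow> c = a \<and> d = b" if "step c d" for c d
    using that \<open>a \<noteq> b\<close> by (intro pair_root_eq_iff) (auto simp: step_def)
  have "wform m n ?\<gamma> ?\<gamma> = 0" using form[OF \<open>step a b\<close>] \<open>a \<noteq> b\<close> by simp
  then have "odd_change m n ?\<gamma> (ranked_simple m n p) =
      {(if c = a \<and> d = b then - ?\<gamma>
        else if wform m n (pair_root c d) ?\<gamma> = 0 then pair_root c d else pair_root c d + ?\<gamma>) | c d. step c d}"
    (is "?O = ?R")
  proof (intro equalityI subsetI)
    fix v assume "v \<in> ?O"
    then consider "v = - ?\<gamma>"
      | c d where "step c d" "v = pair_root c d" "wform m n v ?\<gamma> = 0" "v \<noteq> ?\<gamma>"
      | c d where "step c d" "v = pair_root c d + ?\<gamma>" "wform m n (pair_root c d) ?\<gamma> \<noteq> 0"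
      unfolding odd_change_def S by blast
    then show "v \<in> ?R"
    proof cases
      case 1 then show ?thesis using \<open>step a b\<close> by force
    next
      case 2
      then have "\<not> (c = a \<and> d = b)" by blast
      with 2 show ?thesis by (intro CollectI exI[of _ c] exI[of _ d]) auto
    next
      case 3
      then have "\<not> (c = a \<and> d = b)" using \<open>wform m n ?\<gamma> ?\<gamma> = 0\<close> by blast
      with 3 show ?thesis by (intro CollectI exI[of _ c] exI[of _ d]) auto
    qed
  next
    fix v assume "v \<in> ?R"
    then obtain c d where cd: "step c d" and v: "v = (if c = a \<and> d = b then - ?\<gamma>
        else if wform m n (pair_root c d) ?\<gamma> = 0 then pair_root c d else pair_root c d + ?\<gamma>)" by blast
    have "pair_root c d \<in> ranked_simple m n p" using cd S by blast
    then show "v \<in> ?O" using neq[OF cd] unfolding v odd_change_def by auto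
  qed
  also have "\<dots> = {pair_root (?t c) (?t d) | c d. step c d}"
    using moved by (metis (no_types, lifting))
  also have "\<dots> = ranked_simple m n (p \<circ> ?t)"
    using ab by (simp add: ranked_simple_transposed step_def)
  finally show ?thesis .
qed

lemma r_hat_ranked_simple:
  assumes ab: "a \<in> letters m n" "b \<in> letters m n" "a \<noteq> b" and p: "p \<in> rankings m n"
  shows "r_hat m n (pair_root a b) (ranked_simple m n p) =
    (ranked_simple m n (exchange a b p) :: 'k::field_char_0 weight set)"
proof -
  let ?\<gamma> = "pair_root a b :: 'k weight" and ?B = "ranked_simple m n p :: 'k weight set"
  have "?B \<in> borels m n" using p by (simp add: borels_eq)
  moreover have "odd_reflection m n ?\<gamma> ?B = ranked_simple m n (exchange a b p)"
    if odd: "\<not> same_kind a b"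
  proof -
    consider "p b = Suc (p a)" | "p a = Suc (p b)" | "\<not> adjacent (p a) (p b)"
      by (auto simp: adjacent_def)
    then show ?thesis
    proof cases
      case 1
      then show ?thesis
        using ab odd p by (simp add: odd_reflection_def pair_root_in_ranked_simple
            odd_change_ranked_simple exchange_def adjacent_def)
    next
      case 2
      then show ?thesis
        using ab odd p by (simp add: odd_reflection_def pair_root_in_ranked_simple same_kind_commute[of a]
            odd_change_ranked_simple exchange_def adjacent_def transpose_commute[of a])
    next
      case 3
      then show ?thesis
        using ab odd p by (simp add: odd_reflection_def pair_root_in_ranked_simple
            exchange_def adjacent_def)
    qed
  qed
  ultimately show ?thesis
    using ab by (simp add: r_hat_def pair_root_in_even_roots reflection_ranked_simple)
      (simp add: exchange_def)
qed

section \<open>Orders in the super Weyl group\<close>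

lemma BijGroup_pow_apply:
  assumes "f \<in> Bij S" "x \<in> S"
  shows "(f [^]\<^bsub>BijGroup S\<^esub> (i::nat)) x = (f ^^ i) x"
  using assms(2)
proof (induction i arbitrary: x)
  case 0
  then show ?case by (simp add: BijGroup_def)
next
  case (Suc i)
  interpret group "BijGroup S" by (rule group_BijGroup)
  have carrier: "carrier (BijGroup S) = Bij S" by (simp add: BijGroup_def)
  have pow: "f [^]\<^bsub>BijGroup S\<^esub> i \<in> Bij S"
    using assms(1) nat_pow_closed[of f i] unfolding carrier by simp
  have "f x \<in> S" using assms(1) Suc.prems Bij_imp_funcset by blast
  have "f [^]\<^bsub>BijGroup S\<^esub> Suc i = compose S (f [^]\<^bsub>BijGroup S\<^esub> i) f"
    using assms(1) pow by (simp add: BijGroup_def)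
  then have "(f [^]\<^bsub>BijGroup S\<^esub> Suc i) x = (f [^]\<^bsub>BijGroup S\<^esub> i) (f x)"
    using Suc.prems by (simp add: compose_eq)
  also have "\<dots> = (f ^^ i) (f x)" using \<open>f x \<in> S\<close> by (rule Suc.IH)
  finally show ?case by (simp add: funpow_swap1)
qed

lemma r_hat_self_inverse:
  assumes ab: "a \<in> letters m n" "b \<in> letters m n" "a \<noteq> b"
    and "(B :: 'k::field_char_0 weight set) \<in> borels m n"
  shows "r_hat m n (pair_root a b) B \<in> borels m n" "r_hat m n (pair_root a b) (r_hat m n (pair_root a b) B) = B"
proof -
  from assms obtain p where p: "p \<in> rankings m n" "B = ranked_simple m n p"
    by (auto simp: borels_eq)
  with ab show "r_hat m n (pair_root a b) B \<in> borels m n"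
    by (simp add: r_hat_ranked_simple borels_eq exchange_ranking)
  from p ab show "r_hat m n (pair_root a b) (r_hat m n (pair_root a b) B) = B"
    by (simp add: r_hat_ranked_simple exchange_ranking exchange_involutory)
qed

lemma r_hat_Bij:
  assumes "a \<in> letters m n" "b \<in> letters m n" "a \<noteq> b"
  shows "r_hat m n (pair_root a b :: 'k::field_char_0 weight) \<in> Bij (borels m n)"
proof -
  let ?r = "r_hat m n (pair_root a b :: 'k weight)"
  have "bij_betw ?r (borels m n) (borels m n)"
    using r_hat_self_inverse[OF assms, where 'k='k] by (intro bij_betwI[of _ _ _ ?r]) auto
  then show ?thesis by (simp add: Bij_def r_hat_def)
qed

lemma r_hat_in_super_weyl_group:
  assumes "a \<in> letters m n" "b \<in> letters m n" "a \<noteq> b"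
  shows "r_hat m n (pair_root a b :: 'k::field_char_0 weight) \<in> carrier (super_weyl_group m n)"
proof -
  have "(pair_root a b :: 'k weight) \<in> roots m n" using assms by (auto simp: roots_eq)
  moreover have "r_hat m n (pair_root a b :: 'k weight) \<in> carrier (BijGroup (borels m n))"
    using r_hat_Bij[OF assms] by (simp add: BijGroup_def)
  ultimately show ?thesis
    unfolding super_weyl_group_def carrier_subgroup_generated by (intro generate.incl) blast
qed

lemma group_super_weyl_group: "group (super_weyl_group m n)"
  unfolding super_weyl_group_def by (intro group.group_subgroup_generated group_BijGroup)

text \<open>
  The bijection between rankings and fundamental systems is equivariant, so a power of the product
  is trivial as soon as it fixes all rankings.
\<close>

lemma coxeter_order_r_hat:
  assumes ab: "a \<in> letters m n" "b \<in> letters m n" "a \<noteq> b"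
    and cd: "c \<in> letters m n" "d \<in> letters m n" "c \<noteq> d"
    and order: "\<And>i. (\<forall>p\<in>rankings m n. ((exchange a b \<circ> exchange c d) ^^ i) p = p) \<longleftrightarrow> k dvd i"
  shows "coxeter_order m n (r_hat m n (pair_root a b :: 'k::field_char_0 weight)) (r_hat m n (pair_root c d)) = k"
proof -
  let ?x = "r_hat m n (pair_root a b :: 'k weight)" and ?y = "r_hat m n (pair_root c d :: 'k weight)"
  let ?W = "super_weyl_group m n :: ('k weight set \<Rightarrow> 'k weight set) monoid"
  let ?S = "borels m n :: 'k weight set set" and ?F = "exchange a b \<circ> exchange c d"
  interpret group ?W by (rule group_super_weyl_group)
  have Bij: "?x \<in> Bij ?S" "?y \<in> Bij ?S" using ab cd by (simp_all add: r_hat_Bij)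
  have carrier: "?x \<otimes>\<^bsub>?W\<^esub> ?y \<in> carrier ?W"
    using ab cd by (simp add: r_hat_in_super_weyl_group)
  have xy: "?x \<otimes>\<^bsub>?W\<^esub> ?y = compose ?S ?x ?y"
    using Bij by (simp add: super_weyl_group_def BijGroup_def)
  then have xy_Bij: "?x \<otimes>\<^bsub>?W\<^esub> ?y \<in> Bij ?S" using compose_Bij[OF Bij] by simp
  have step: "(?x \<otimes>\<^bsub>?W\<^esub> ?y) (ranked_simple m n p) = ranked_simple m n (?F p)"
    if "p \<in> rankings m n" for p
    using that ab cd by (simp add: xy compose_eq borels_eq r_hat_ranked_simple exchange_ranking)
  have iterate: "((?x \<otimes>\<^bsub>?W\<^esub> ?y) ^^ i) (ranked_simple m n p) = ranked_simple m n ((?F ^^ i) p)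
      \<and> (?F ^^ i) p \<in> rankings m n" if "p \<in> rankings m n" for p i
    by (induction i) (use that ab cd in \<open>simp_all add: step exchange_ranking\<close>)
  have "(?x \<otimes>\<^bsub>?W\<^esub> ?y) [^]\<^bsub>?W\<^esub> i = \<one>\<^bsub>?W\<^esub> \<longleftrightarrow> k dvd i" for i :: nat
  proof -
    let ?g = "(?x \<otimes>\<^bsub>?W\<^esub> ?y) [^]\<^bsub>?W\<^esub> i"
    have one: "\<one>\<^bsub>?W\<^esub> = (\<lambda>B\<in>?S. B)" by (simp add: super_weyl_group_def BijGroup_def)
    have "carrier ?W \<subseteq> carrier (BijGroup ?S)"
      unfolding super_weyl_group_def
      by (rule group.carrier_subgroup_generated_subset[OF group_BijGroup])
    then have "carrier ?W \<subseteq> Bij ?S" by (simp add: BijGroup_def)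
    then have ext: "?g \<in> extensional ?S" "\<one>\<^bsub>?W\<^esub> \<in> extensional ?S"
      using nat_pow_closed[OF carrier, of i] one_closed Bij_imp_extensional by blast+
    have val: "?g (ranked_simple m n p) = ranked_simple m n ((?F ^^ i) p)"
      if "p \<in> rankings m n" for p
      using that iterate[OF that, of i] BijGroup_pow_apply[OF xy_Bij, of "ranked_simple m n p" i]
      by (simp add: super_weyl_group_def pow_subgroup_generated borels_eq)
    have "?g = \<one>\<^bsub>?W\<^esub> \<longleftrightarrow> (\<forall>B\<in>?S. ?g B = B)"
    proof
      assume "?g = \<one>\<^bsub>?W\<^esub>" then show "\<forall>B\<in>?S. ?g B = B" by (simp add: one)
    next
      assume "\<forall>B\<in>?S. ?g B = B"
      then show "?g = \<one>\<^bsub>?W\<^esub>" by (intro extensionalityI[OF ext]) (simp add: one)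
    qed
    also have "\<dots> \<longleftrightarrow> (\<forall>p\<in>rankings m n. (?F ^^ i) p = p)"
      using iterate inj_on_eq_iff[OF inj_on_ranked_simple[where 'k='k]]
      by (simp add: borels_eq val)
    finally show ?thesis using order by simp
  qed
  then show ?thesis
    unfolding coxeter_order_def using ord_unique[OF carrier] by simp
qed

text \<open>The two products are inverse to each other, as both factors are involutions.\<close>

lemma coxeter_order_r_hat_commute:
  assumes ab: "a \<in> letters m n" "b \<in> letters m n" "a \<noteq> b"
    and cd: "c \<in> letters m n" "d \<in> letters m n" "c \<noteq> d"
  shows "coxeter_order m n (r_hat m n (pair_root a b :: 'k::field_char_0 weight)) (r_hat m n (pair_root c d)) =
    coxeter_order m n (r_hat m n (pair_root c d)) (r_hat m n (pair_root a b :: 'k weight))"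
proof -
  let ?W = "super_weyl_group m n :: ('k weight set \<Rightarrow> 'k weight set) monoid"
  interpret group ?W by (rule group_super_weyl_group)
  have self_inverse: "inv\<^bsub>?W\<^esub> (r_hat m n (pair_root e f)) = r_hat m n (pair_root e f)"
    if "e \<in> letters m n" "f \<in> letters m n" "e \<noteq> f" for e f
  proof (rule inv_equality)
    show "r_hat m n (pair_root e f) \<otimes>\<^bsub>?W\<^esub> r_hat m n (pair_root e f) = \<one>\<^bsub>?W\<^esub>"
      using that by (auto simp: super_weyl_group_def BijGroup_def r_hat_Bij compose_def
          r_hat_self_inverse intro!: restrict_ext)
  qed (use that in \<open>simp_all add: r_hat_in_super_weyl_group\<close>)
  have "ord (r_hat m n (pair_root c d) \<otimes>\<^bsub>?W\<^esub> r_hat m n (pair_root a b)) =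
      ord (inv\<^bsub>?W\<^esub> (r_hat m n (pair_root a b) \<otimes>\<^bsub>?W\<^esub> r_hat m n (pair_root c d)))"
    using ab cd by (simp add: inv_mult_group r_hat_in_super_weyl_group self_inverse)
  then show ?thesis
    using ab cd by (simp add: coxeter_order_def r_hat_in_super_weyl_group)
qed

section \<open>Orders of products of two exchanges\<close>

lemma period_dvd:
  assumes "(f ^^ k) x = x" "\<And>r. 0 < r \<Longrightarrow> r < k \<Longrightarrow> (f ^^ r) x \<noteq> x" "0 < k" "(f ^^ i) x = x"
  shows "k dvd i"
proof -
  have "(f ^^ (i mod k)) x = x" using assms(1,4) by (simp add: funpow_mod_eq)
  then have "i mod k = 0" using assms(2)[of "i mod k"] assms(3) by fastforce
  then show ?thesis by blast
qed

lemma card_subset_letters: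
  assumes "A \<subseteq> letters m n"
  shows "card A \<le> m + n"
  using card_mono[OF finite_letters assms] by simp

lemma exchange_order_disjoint:
  assumes L: "a \<in> letters m n" "b \<in> letters m n" and "a \<noteq> b" and disj: "{a, b} \<inter> {c, d} = {}"
  shows "(\<forall>p\<in>rankings m n. ((exchange a b \<circ> exchange c d) ^^ i) p = p) \<longleftrightarrow> 2 dvd i"
proof
  let ?F = "exchange a b \<circ> exchange c d"
  have square: "(?F ^^ 2) p = p" for p
  proof -
    have ne: "a \<noteq> c" "a \<noteq> d" "b \<noteq> c" "b \<noteq> d" using disj by auto
    then have "transpose c d (transpose a b x) = transpose a b (transpose c d x)" for x
      by (simp add: transpose_def)
    then have "exchange c d (exchange a b q) = exchange a b (exchange c d q)" for q
      using ne by (simp add: exchange_def fun_eq_iff transpose_apply_other)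
    then show ?thesis by (simp add: eval_nat_numeral exchange_involutory)
  qed
  have "card {a, b} \<le> m + n" using L by (intro card_subset_letters) simp
  then have two: "2 \<le> m + n" using \<open>a \<noteq> b\<close> by simp
  obtain p where p: "p \<in> rankings m n"
    and p_vals: "\<And>x. x \<in> {a, b} \<Longrightarrow> p x = (if x = a then 0 else 1)"
    by (rule rankings_extend[of "{a, b}" m n "\<lambda>x. if x = a then 0 else 1"])
      (use L two \<open>a \<noteq> b\<close> in auto)
  have "a \<noteq> c" "a \<noteq> d" "b \<noteq> c" "b \<noteq> d" using disj by auto
  then have "exchange c d p a = 0" "exchange c d p b = 1"
    using p_vals[of a] p_vals[of b] \<open>a \<noteq> b\<close> by (simp_all add: exchange_apply)
  then have "?F p a = 1" by (simp add: exchange_apply adjacent_def)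
  then have "?F p \<noteq> p" using p_vals[of a] by auto
  then show "2 dvd i" if "\<forall>p\<in>rankings m n. (?F ^^ i) p = p"
    using that p square by (intro period_dvd[of 2 ?F p]) (auto simp: less_2_cases_iff)
  show "\<forall>p\<in>rankings m n. (?F ^^ i) p = p" if "2 dvd i"
    using that square funpow_mod_eq[of 2 ?F _ i] by (auto simp: mod_eq_0_iff_dvd)
qed

lemma funpow_on_triple:
  assumes coords: "\<And>p. (F p a, F p b, F p c) = T (p a, p b, p c)"
    and rest: "\<And>p x. x \<notin> {a, b, c} \<Longrightarrow> F p x = p x"
  shows "((F ^^ i) p a, (F ^^ i) p b, (F ^^ i) p c) = (T ^^ i) (p a, p b, p c)"
    and "x \<notin> {a, b, c} \<Longrightarrow> (F ^^ i) p x = p x"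
  by (induction i) (simp_all add: coords rest)

text \<open>
  If a map of rankings only moves the ranks of three letters, and by a rule \<open>T\<close> that sees nothing
  but these three ranks, then its order can be computed from \<open>T\<close>.  All triples of distinct ranks
  occur, so a period that \<open>T\<close> has on one of them is a lower bound.
\<close>

lemma order_from_triple:
  assumes coords: "\<And>p. (F p a, F p b, F p c) = T (p a, p b, p c)"
    and rest: "\<And>p x. x \<notin> {a, b, c} \<Longrightarrow> F p x = p x"
    and L: "{a, b, c} \<subseteq> letters m n" and ne: "a \<noteq> b" "a \<noteq> c" "b \<noteq> c"
    and period: "\<And>t. (T ^^ k) t = t"
    and minimal: "\<And>i. (\<And>u v w. distinct [u, v, w] \<Longrightarrow> {u, v, w} \<subseteq> {..<m + n} \<Longrightarrow>
      (T ^^ i) (u, v, w) = (u, v, w)) \<Longrightarrow> k dvd i"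
  shows "(\<forall>p\<in>rankings m n. (F ^^ i) p = p) \<longleftrightarrow> k dvd i"
proof
  assume fixed: "\<forall>p\<in>rankings m n. (F ^^ i) p = p"
  show "k dvd i"
  proof (rule minimal)
    fix u v w :: nat
    assume uvw: "distinct [u, v, w]" "{u, v, w} \<subseteq> {..<m + n}"
    obtain p where "p \<in> rankings m n"
      and p_vals: "\<And>x. x \<in> {a, b, c} \<Longrightarrow> p x = (if x = a then u else if x = b then v else w)"
      by (rule rankings_extend[OF L, of "\<lambda>x. if x = a then u else if x = b then v else w"])
        (use uvw ne in auto)
    then have "(p a, p b, p c) = (T ^^ i) (p a, p b, p c)"
      using fixed funpow_on_triple(1)[where F = F and T = T and i = i and p = p, OF coords rest] by simp
    then show "(T ^^ i) (u, v, w) = (u, v, w)"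
      using p_vals[of a] p_vals[of b] p_vals[of c] ne by simp
  qed
next
  assume "k dvd i"
  then have T: "(T ^^ i) t = t" for t
    using period[of t] funpow_mod_eq[of k T t i] by (auto simp: mod_eq_0_iff_dvd)
  show "\<forall>p\<in>rankings m n. (F ^^ i) p = p"
  proof (intro ballI ext)
    fix p x
    show "(F ^^ i) p x = p x"
      using funpow_on_triple[where F = F and T = T and i = i and p = p, OF coords rest]
        T[of "(p a, p b, p c)"] by (cases "x \<in> {a, b, c}") auto
  qed
qed

lemma exchange_order_same_kind:
  assumes L: "{a, b, c} \<subseteq> letters m n" and ne: "a \<noteq> b" "a \<noteq> c" "b \<noteq> c"
    and kind: "same_kind a b" "same_kind b c"
  shows "(\<forall>p\<in>rankings m n. ((exchange a b \<circ> exchange b c) ^^ i) p = p) \<longleftrightarrow> 3 dvd i"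
proof -
  define T :: "nat \<times> nat \<times> nat \<Rightarrow> nat \<times> nat \<times> nat" where "T = (\<lambda>(u, v, w). (w, u, v))"
  have cube: "(T ^^ 3) t = t" for t by (cases t) (simp add: T_def eval_nat_numeral)
  have "card {a, b, c} \<le> m + n" using L by (rule card_subset_letters)
  then have three: "3 \<le> m + n" using ne by simp
  show ?thesis
  proof (rule order_from_triple[OF _ _ L ne, where T = T])
    fix p
    show "((exchange a b \<circ> exchange b c) p a, (exchange a b \<circ> exchange b c) p b,
        (exchange a b \<circ> exchange b c) p c) = T (p a, p b, p c)"
      using kind ne by (simp add: T_def exchange_apply)
    show "(exchange a b \<circ> exchange b c) p x = p x" if "x \<notin> {a, b, c}" for x
      using that by (simp add: exchange_apply)
  next
    fix i assume fixed: "\<And>u v w. distinct [u, v, w] \<Longrightarrow> {u, v, w} \<subseteq> {..<m + n} \<Longrightarrow>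
      (T ^^ i) (u, v, w) = (u, v, w)"
    have "(T ^^ i) (0, 1, 2) = (0, 1, 2)" by (rule fixed) (use three in auto)
    moreover have "(T ^^ r) (0, 1, 2) \<noteq> (0, 1, 2)" if "0 < r" "r < 3" for r
    proof -
      have "r = 1 \<or> r = 2" using that by arith
      then show ?thesis by (auto simp: T_def eval_nat_numeral)
    qed
    ultimately show "3 dvd i" using cube by (intro period_dvd[of 3 T "(0, 1, 2)"]) simp_all
  qed (rule cube)
qed

text \<open>
  The rule for the three ranks depends only on which of them are neighbours.  Checking all patterns
  of neighbourhood gives that its twelfth power is trivial, while the orbits of
  \<open>(0, 1, 2)\<close> and \<open>(0, 1, 3)\<close>, with two pairs and one pair of neighbours, have lengths 6 and 4.
\<close>

lemma exchange_order_mixed: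
  assumes L: "{a, b, c} \<subseteq> letters m n" and ne: "a \<noteq> c"
    and kind: "same_kind c a" "\<not> same_kind a b" and four: "4 \<le> m + n"
  shows "(\<forall>p\<in>rankings m n. ((exchange c a \<circ> exchange a b) ^^ i) p = p) \<longleftrightarrow> 12 dvd i"
proof -
  define T :: "nat \<times> nat \<times> nat \<Rightarrow> nat \<times> nat \<times> nat" where
    "T = (\<lambda>(u, v, w). if adjacent u v then (w, u, v) else (w, v, u))"
  have twelve: "(T ^^ 12) t = t" for t
  proof (cases t)
    case (fields u v w)
    show ?thesis
      unfolding fields
      by (cases "adjacent u v"; cases "adjacent v w"; cases "adjacent u w")
        (simp_all add: T_def eval_nat_numeral adjacent_commute[of v u] adjacent_commute[of w v]
          adjacent_commute[of w u])
  qed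
  have ne': "a \<noteq> b" "b \<noteq> c" using kind by (cases a; cases b; cases c; auto)+
  show ?thesis
  proof (rule order_from_triple[OF _ _ L ne'(1) ne ne'(2), where T = T])
    fix p
    show "((exchange c a \<circ> exchange a b) p a, (exchange c a \<circ> exchange a b) p b,
        (exchange c a \<circ> exchange a b) p c) = T (p a, p b, p c)"
      using kind ne ne' by (auto simp: T_def exchange_apply)
    show "(exchange c a \<circ> exchange a b) p x = p x" if "x \<notin> {a, b, c}" for x
      using that by (simp add: exchange_apply)
  next
    fix i assume fixed: "\<And>u v w. distinct [u, v, w] \<Longrightarrow> {u, v, w} \<subseteq> {..<m + n} \<Longrightarrow>
      (T ^^ i) (u, v, w) = (u, v, w)"
    have fixed_012: "(T ^^ i) (0, 1, 2) = (0, 1, 2)" by (rule fixed) (use four in auto)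
    have fixed_013: "(T ^^ i) (0, 1, 3) = (0, 1, 3)" by (rule fixed) (use four in auto)
    have "6 dvd i"
    proof (rule period_dvd[of 6 T "(0, 1, 2)"])
      show "(T ^^ r) (0, 1, 2) \<noteq> (0, 1, 2)" if "0 < r" "r < 6" for r
      proof -
        have "r = 1 \<or> r = 2 \<or> r = 3 \<or> r = 4 \<or> r = 5" using that by arith
        then show ?thesis by (elim disjE) (simp_all add: T_def adjacent_def eval_nat_numeral)
      qed
      show "(T ^^ 6) (0, 1, 2) = (0, 1, 2)" by (simp add: T_def adjacent_def eval_nat_numeral)
    qed (use fixed_012 in simp_all)
    moreover have "4 dvd i"
    proof (rule period_dvd[of 4 T "(0, 1, 3)"])
      show "(T ^^ r) (0, 1, 3) \<noteq> (0, 1, 3)" if "0 < r" "r < 4" for r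
      proof -
        have "r = 1 \<or> r = 2 \<or> r = 3" using that by arith
        then show ?thesis by (elim disjE) (simp_all add: T_def adjacent_def eval_nat_numeral)
      qed
      show "(T ^^ 4) (0, 1, 3) = (0, 1, 3)" by (simp add: T_def adjacent_def eval_nat_numeral)
    qed (use fixed_013 in simp_all)
    ultimately show "12 dvd i" by presburger
  qed (rule twelve)
qed

section \<open>The Coxeter graph\<close>

text \<open>
  Numbering the letters consecutively across both kinds makes the generators a single chain,
  in which the \<open>m\<close>-th one is the odd reflection.
\<close>

definition letter :: "nat \<Rightarrow> nat \<Rightarrow> diag_index" where
  "letter m k = (if k \<le> m then Bar k else Plain (k - m))"

lemma letter_in_letters: "1 \<le> k \<Longrightarrow> k \<le> m + n \<Longrightarrow> letter m k \<in> letters m n"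
  by (cases "k \<le> m") (simp_all add: letter_def letters_def image_iff, linarith)

lemma letter_eq_iff: "letter m j = letter m k \<longleftrightarrow> j = k"
  by (auto simp: letter_def)

lemma same_kind_letter: "same_kind (letter m j) (letter m k) \<longleftrightarrow> (j \<le> m \<longleftrightarrow> k \<le> m)"
  by (simp add: letter_def)

definition chain_reflection ::
    "nat \<Rightarrow> nat \<Rightarrow> nat \<Rightarrow> 'k::field weight set \<Rightarrow> 'k weight set" where
  "chain_reflection m n k = r_hat m n (pair_root (letter m k) (letter m (Suc k)))"

lemma chain_reflection_eq:
  "1 \<le> i \<Longrightarrow> i < m \<Longrightarrow> chain_reflection m n i = r_hat m n (\<delta> i - \<delta> (i + 1))"
  "chain_reflection m n m = r_hat m n (\<delta> m - \<epsilon> 1)"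
  "1 \<le> j \<Longrightarrow> chain_reflection m n (m + j) = r_hat m n (\<epsilon> j - \<epsilon> (j + 1))"
  by (simp_all add: chain_reflection_def letter_def pair_root_def delta_eq epsilon_eq Suc_diff_le)

lemma coxeter_generators_eq:
  assumes "1 \<le> m" "1 \<le> n"
  shows "(coxeter_generators m n :: ('k::field weight set \<Rightarrow> _) set) =
    chain_reflection m n ` {1..<m + n}"
proof -
  have split: "{1..<m + n} = {1..<m} \<union> {m} \<union> (\<lambda>j. m + j) ` {1..<n}"
  proof -
    have "k \<in> (\<lambda>j. m + j) ` {1..<n}" if "m < k" "k < m + n" for k
      using that by (intro image_eqI[of _ _ "k - m"]) auto
    then show ?thesis using assms by (force simp: not_less)
  qed
  have "(coxeter_generators m n :: ('k weight set \<Rightarrow> _) set) =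
      (\<lambda>i. r_hat m n (\<delta> i - \<delta> (i + 1))) ` {1..<m} \<union> {r_hat m n (\<delta> m - \<epsilon> 1)} \<union>
      (\<lambda>j. r_hat m n (\<epsilon> j - \<epsilon> (j + 1))) ` {1..<n}"
  proof -
    have as_image: "{f i | i. 1 \<le> i \<and> i < N} = f ` {1..<N}" for f :: "nat \<Rightarrow> 'k weight" and N
      by auto
    show ?thesis
      unfolding coxeter_generators_def standard_simple_roots_def as_image
      by (simp only: image_Un image_image image_insert image_empty)
  qed
  also have "\<dots> = chain_reflection m n ` {1..<m + n}"
    unfolding split image_Un image_image
    by (intro arg_cong2[where f = "(\<union>)"] image_cong) (simp_all add: chain_reflection_eq)
  finally show ?thesis .
qed

text \<open>The Coxeter matrix of the chain; the two edges at the vertex \<open>m\<close> have the label 12.\<close>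

definition chain_order :: "nat \<Rightarrow> nat \<Rightarrow> nat \<Rightarrow> nat" where
  "chain_order m j k = (if j = k then 1 else if \<not> adjacent j k then 2
     else if j = m \<or> k = m then 12 else 3)"

text \<open>
  The condition on \<open>j\<close> and \<open>k\<close> selects one of the two orders of each pair, with the odd exchange
  written on the right, as in \<open>exchange_order_mixed\<close>, when the other factor is its neighbour in
  the chain.
\<close>

lemma exchange_order_chain:
  assumes N: "4 \<le> m + n" and range: "j \<in> {1..<m + n}" "k \<in> {1..<m + n}"
    and order: "j \<le> k \<and> \<not> (j = m \<and> k = Suc m) \<or> j = Suc m \<and> k = m"
  shows "(\<forall>p\<in>rankings m n.
    ((exchange (letter m j) (letter m (Suc j)) \<circ> exchange (letter m k) (letter m (Suc k))) ^^ i) p = p)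
    \<longleftrightarrow> chain_order m j k dvd i" (is "?order (chain_order m j k)")
proof -
  let ?l = "letter m"
  consider "k = j" | "j + 1 < k" | "k = Suc j" "Suc j = m" | "j = Suc m" "k = m"
    | "k = Suc j" "j \<noteq> m" "Suc j \<noteq> m" using order by linarith
  then show "?order (chain_order m j k)"
  proof cases
    case 1
    have "((exchange a b \<circ> exchange a b) ^^ i) p = p" for a b p
      by (induction i) (simp_all add: exchange_involutory)
    then have "?order 1" unfolding 1 by (simp only: one_dvd) blast
    moreover have "chain_order m j k = 1" using 1 by (simp add: chain_order_def)
    ultimately show ?thesis by (simp only:)
  next
    case 2
    then have "?order 2"
      using range by (intro exchange_order_disjoint letter_in_letters) (auto simp: letter_eq_iff)
    then show ?thesis using 2 by (simp add: chain_order_def adjacent_def)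
  next
    case 3
    have "?order 12"
      unfolding 3 by (rule exchange_order_mixed)
        (use 3 range N in \<open>auto simp: letter_eq_iff same_kind_letter letter_in_letters\<close>)
    moreover have "chain_order m j k = 12" using 3 by (simp add: chain_order_def adjacent_def)
    ultimately show ?thesis by (simp only:)
  next
    case 4
    have "(\<forall>p\<in>rankings m n. ((exchange (?l (Suc (Suc m))) (?l (Suc m)) \<circ>
        exchange (?l (Suc m)) (?l m)) ^^ i) p = p) \<longleftrightarrow> 12 dvd i"
      by (rule exchange_order_mixed)
        (use 4 range N in \<open>auto simp: letter_eq_iff same_kind_letter letter_in_letters\<close>)
    then have "?order 12"
      unfolding 4 exchange_commute[of "?l (Suc (Suc m))"] exchange_commute[of "?l (Suc m)" "?l m"] .
    moreover have "chain_order m j k = 12" using 4 by (simp add: chain_order_def adjacent_def)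
    ultimately show ?thesis by (simp only:)
  next
    case 5
    have "?order 3"
      unfolding 5(1)
      by (rule exchange_order_same_kind)
        (use 5 range in \<open>auto simp: letter_eq_iff same_kind_letter letter_in_letters\<close>)
    then show ?thesis using 5 by (simp add: chain_order_def adjacent_def)
  qed
qed

lemma chain_order_commute: "chain_order m j k = chain_order m k j"
  by (auto simp: chain_order_def adjacent_commute)

lemma coxeter_order_chain:
  assumes N: "4 \<le> m + n" and range: "j \<in> {1..<m + n}" "k \<in> {1..<m + n}"
  shows "coxeter_order m n (chain_reflection m n j :: 'k::field_char_0 weight set \<Rightarrow> _)
    (chain_reflection m n k) = chain_order m j k"
proof -
  let ?c = "chain_reflection m n :: nat \<Rightarrow> 'k weight set \<Rightarrow> 'k weight set"
  define good where "good j k \<longleftrightarrow> j \<le> k \<and> \<not> (j = m \<and> k = Suc m) \<or> j = Suc m \<and> k = m" for j k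
  have letters: "letter m i \<in> letters m n" "letter m (Suc i) \<in> letters m n"
    "letter m i \<noteq> letter m (Suc i)" if "i \<in> {1..<m + n}" for i
    using that by (simp_all add: letter_in_letters letter_eq_iff)
  have good: "coxeter_order m n (?c j) (?c k) = chain_order m j k"
    if "good j k" "j \<in> {1..<m + n}" "k \<in> {1..<m + n}" for j k
    unfolding chain_reflection_def
    using that N letters exchange_order_chain unfolding good_def
    by (intro coxeter_order_r_hat) simp_all
  have "good j k \<or> good k j" by (auto simp: good_def)
  then show ?thesis
  proof
    assume "good k j"
    then have "coxeter_order m n (?c k) (?c j) = chain_order m j k"
      using good range chain_order_commute by metis
    moreover have "coxeter_order m n (?c j) (?c k) = coxeter_order m n (?c k) (?c j)"
      unfolding chain_reflection_def using letters range by (intro coxeter_order_r_hat_commute)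
    ultimately show ?thesis by simp
  qed (use good range in blast)
qed

text \<open>
  Equal generators would have a product of order 1, which the table of orders excludes off the
  diagonal.
\<close>

lemma inj_on_chain_reflection:
  assumes "4 \<le> m + n"
  shows "inj_on (chain_reflection m n :: nat \<Rightarrow> 'k::field_char_0 weight set \<Rightarrow> _) {1..<m + n}"
proof (rule inj_onI)
  fix j k
  assume range: "j \<in> {1..<m + n}" "k \<in> {1..<m + n}"
    and "chain_reflection m n j = (chain_reflection m n k :: 'k weight set \<Rightarrow> _)"
  then have "chain_order m j k = chain_order m k k"
    using coxeter_order_chain[OF assms, where 'k='k] by metis
  then show "j = k" by (simp add: chain_order_def split: if_splits)
qed

lemma coxeter_graph_chain:
  assumes inj: "inj_on c {1..<N}"
    and M: "\<And>j k. j \<in> {1..<N} \<Longrightarrow> k \<in> {1..<N} \<Longrightarrow> M (c j) (c k) = chain_order m j k"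
  shows "coxeter_graph (c ` {1..<N}) M = (c ` {1..<N},
    {({c j, c (Suc j)}, if j = m \<or> Suc j = m then Some 12 else None) | j. 1 \<le> j \<and> Suc j < N})"
proof -
  let ?I = "{1..<N}"
  have "{({x, y}, if M x y = 3 then None else Some (M x y)) | x y.
            x \<in> c ` ?I \<and> y \<in> c ` ?I \<and> x \<noteq> y \<and> (M x y \<ge> 3 \<or> M x y = 0)} =
    {({c j, c (Suc j)}, if j = m \<or> Suc j = m then Some 12 else None) | j. 1 \<le> j \<and> Suc j < N}"
    (is "?E = ?E'")
  proof (intro equalityI subsetI)
    fix e assume "e \<in> ?E"
    then obtain j k where jk: "j \<in> ?I" "k \<in> ?I" "c j \<noteq> c k" "M (c j) (c k) \<ge> 3 \<or> M (c j) (c k) = 0"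
      and e: "e = ({c j, c k}, if M (c j) (c k) = 3 then None else Some (M (c j) (c k)))" by blast
    from jk have adj: "adjacent j k" by (auto simp: M chain_order_def split: if_splits)
    then have "chain_order m j k = (if j = m \<or> k = m then 12 else 3)"
      by (auto simp: chain_order_def adjacent_def)
    then have e': "e = ({c j, c k}, if j = m \<or> k = m then Some 12 else None)"
      using e jk by (simp add: M)
    from adj consider "k = Suc j" | "j = Suc k" by (auto simp: adjacent_def)
    then show "e \<in> ?E'"
    proof cases
      case 1
      then show ?thesis using e' jk by (intro CollectI exI[of _ j]) auto
    next
      case 2
      then show ?thesis using e' jk by (intro CollectI exI[of _ k]) auto
    qed
  next
    fix e assume "e \<in> ?E'"
    then obtain j where j: "1 \<le> j" "Suc j < N"
      and e: "e = ({c j, c (Suc j)}, if j = m \<or> Suc j = m then Some 12 else None)" by blast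
    have range: "j \<in> ?I" "Suc j \<in> ?I" using j by auto
    then have "c j \<noteq> c (Suc j)" using inj by (auto dest: inj_onD)
    moreover have "M (c j) (c (Suc j)) = (if j = m \<or> Suc j = m then 12 else 3)"
      using M[OF range] by (simp add: chain_order_def adjacent_def)
    ultimately show "e \<in> ?E"
      using range e by (intro CollectI exI[of _ "c j"] exI[of _ "c (Suc j)"]) auto
  qed
  then show ?thesis by (simp add: coxeter_graph_def)
qed

theorem theorem2p6:
  fixes m n :: nat
    and S :: "('k::{alg_closed_field,field_char_0} weight set \<Rightarrow> 'k weight set) set"
    and rbar rplain :: "nat \<Rightarrow> 'k weight set \<Rightarrow> 'k weight set"
    and rodd :: "'k weight set \<Rightarrow> 'k weight set"
  assumes "m \<ge> 1" and "n \<ge> 1" and "m + n \<ge> 4"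
    and "S = coxeter_generators m n"
    and "rbar = (\<lambda>i. r_hat m n (\<delta> i - \<delta> (i + 1)))"
    and "rodd = r_hat m n (\<delta> m - \<epsilon> 1)"
    and "rplain = (\<lambda>j. r_hat m n (\<epsilon> j - \<epsilon> (j + 1)))"
  shows "coxeter_matrix S (coxeter_order m n) \<and>
    distinct (map rbar [1..<m] @ [rodd] @ map rplain [1..<n]) \<and>
    coxeter_graph S (coxeter_order m n) =
      (set (map rbar [1..<m] @ [rodd] @ map rplain [1..<n]),
       {({rbar i, rbar (i + 1)}, None) | i. 1 \<le> i \<and> i + 1 < m} \<union>
       (if m \<ge> 2 then {({rbar (m - 1), rodd}, Some 12)} else {}) \<union>
       (if n \<ge> 2 then {({rodd, rplain 1}, Some 12)} else {}) \<union>
       {({rplain j, rplain (j + 1)}, None) | j. 1 \<le> j \<and> j + 1 < n})"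
proof -
  define c :: "nat \<Rightarrow> 'k weight set \<Rightarrow> 'k weight set" where "c = chain_reflection m n"
  have c_bar: "rbar i = c i" if "1 \<le> i" "i < m" for i
    using that assms(5) by (simp add: c_def chain_reflection_eq(1))
  have c_odd: "rodd = c m" using assms(6) by (simp add: c_def chain_reflection_eq(2))
  have c_plain: "rplain j = c (m + j)" if "1 \<le> j" for j
    using that assms(7) by (simp add: c_def chain_reflection_eq(3))
  have S: "S = c ` {1..<m + n}"
    using assms(1,2,4) by (simp add: c_def coxeter_generators_eq)
  have inj: "inj_on c {1..<m + n}"
    unfolding c_def by (rule inj_on_chain_reflection[OF assms(3)])
  have M: "coxeter_order m n (c j) (c k) = chain_order m j k"
    if "j \<in> {1..<m + n}" "k \<in> {1..<m + n}" for j k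
    unfolding c_def by (rule coxeter_order_chain[OF assms(3) that])
  have "coxeter_matrix S (coxeter_order m n)"
    unfolding coxeter_matrix_def S
    by (auto simp: M chain_order_def adjacent_commute split: if_splits)
  moreover have vertices: "map rbar [1..<m] @ [rodd] @ map rplain [1..<n] = map c [1..<m + n]"
  proof -
    have "[1..<m + n] = [1..<m] @ [m] @ map ((+) m) [1..<n]"
    proof -
      have "map ((+) m) [1..<n] = [Suc m..<m + n]"
        by (induction n) auto
      moreover have "[1..<m + n] = [1..<m] @ [m..<m + n]"
        using upt_add_eq_append[of 1 m n] assms(1) by simp
      moreover have "[m..<m + n] = m # [Suc m..<m + n]"
        using assms(2) by (simp add: upt_conv_Cons)
      ultimately show ?thesis by simp
    qed
    then show ?thesis by (simp add: c_bar c_odd c_plain)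
  qed
  moreover have "distinct (map c [1..<m + n])"
    using inj by (simp add: distinct_map)
  moreover have "{({c j, c (Suc j)}, if j = m \<or> Suc j = m then Some (12::nat) else None) | j.
        1 \<le> j \<and> Suc j < m + n} =
      {({rbar i, rbar (i + 1)}, None) | i. 1 \<le> i \<and> i + 1 < m} \<union>
       (if m \<ge> 2 then {({rbar (m - 1), rodd}, Some 12)} else {}) \<union>
       (if n \<ge> 2 then {({rodd, rplain 1}, Some 12)} else {}) \<union>
       {({rplain j, rplain (j + 1)}, None) | j. 1 \<le> j \<and> j + 1 < n}" (is "?E = ?B \<union> ?O \<union> ?O' \<union> ?P")
  proof -
    let ?e = "\<lambda>j. ({c j, c (Suc j)}, if j = m \<or> Suc j = m then Some (12::nat) else None)"
    have "{j. 1 \<le> j \<and> Suc j < m + n} = {i. 1 \<le> i \<and> i + 1 < m} \<union>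
        (if m \<ge> 2 then {m - 1} else {}) \<union> (if n \<ge> 2 then {m} else {}) \<union>
        (+) m ` {j. 1 \<le> j \<and> j + 1 < n}" (is "?J = ?J'")
    proof -
      have "j \<in> ?J'" if j: "1 \<le> j" "Suc j < m + n" for j
      proof -
        consider "j + 1 < m" | "j = m - 1" "2 \<le> m" | "j = m" "2 \<le> n" | "m < j"
          using j by linarith
        then show ?thesis
        proof cases
          case 4
          then have "j \<in> (+) m ` {j. 1 \<le> j \<and> j + 1 < n}"
            using that by (intro image_eqI[of _ _ "j - m"]) auto
          then show ?thesis by blast
        qed (use that in auto)
      qed
      moreover have "?J' \<subseteq> ?J" using assms(1,2) by (auto split: if_splits)
      ultimately show ?thesis by blast
    qed
    then have "?E = ?e ` ?J'" by blast
    also have "\<dots> = ?e ` {i. 1 \<le> i \<and> i + 1 < m} \<union> ?e ` (if m \<ge> 2 then {m - 1} else {}) \<union>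
        ?e ` (if n \<ge> 2 then {m} else {}) \<union> ?e ` (+) m ` {j. 1 \<le> j \<and> j + 1 < n}"
      by (simp only: image_Un)
    also have "?e ` {i. 1 \<le> i \<and> i + 1 < m} = ?B"
      unfolding setcompr_eq_image by (intro image_cong) (auto simp: c_bar)
    also have "?e ` (if m \<ge> 2 then {m - 1} else {}) = ?O"
      by (simp add: c_bar c_odd)
    also have "?e ` (if n \<ge> 2 then {m} else {}) = ?O'"
      by (simp add: c_plain c_odd)
    also have "?e ` (+) m ` {j. 1 \<le> j \<and> j + 1 < n} = ?P"
      unfolding setcompr_eq_image image_image by (intro image_cong) (auto simp: c_plain)
    finally show ?thesis .
  qed
  moreover have "coxeter_graph S (coxeter_order m n) = (c ` {1..<m + n},
      {({c j, c (Suc j)}, if j = m \<or> Suc j = m then Some 12 else None) | j. 1 \<le> j \<and> Suc j < m + n})"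
    unfolding S
    by (rule coxeter_graph_chain[where c = c and M = "coxeter_order m n" and m = m, OF inj M])
  ultimately show ?thesis by simp
qed

end
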